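(* Let $S$ be a commutative unital semiring with zero containing an element of infinite multiplicative order, and let $n$ be a positive integer. The taiga monoid $\mathrm{taig}_n$ of rank $n$ admits a faithful representation by upper triangular matrices of size $3n^2-2n$ over $S$ (that is, an injective monoid homomorphism $\mathrm{taig}_n\to\mathrm{UT}_{3n^2-2n}(S)$) having block-diagonal structure with largest block of size $3$ (or size $1$ if $n=1$).
   Context: $[n]=\{1,\dots,n\}$, and $[n]^*$ is the free monoid on $[n]$. $\mathrm{UT}_m(S)$ is the monoid of $m\times m$ upper triangular matrices over the semiring $S$ (entries below the diagonal equal to $0_S$) under matrix multiplication. A binary search tree with multiplicities is a (possibly empty) rooted binary tree, with children designated left and right, whose vertices have pairwise distinct positive integer labels, such that the label of each vertex is greater than every label in its left subtree and less than every label in its right subtree, and each vertex label is assigned a positive integer multiplicity. Insertion of a symbol $a$ into such a tree $T$: if $T$ is empty, create a vertex labelled $a$ with multiplicity $1$; otherwise let $x$ be the label of the root; if $a<x$ recursively insert $a$ into the left subtree of the root, if $a>x$ recursively insert $a$ into the right subtree, and if $a=x$ increase the multiplicity of $x$ by $1$. For a word $u$ over the positive integers, $\mathrm{P}_{\mathrm{taig}}(u)$ is the tree obtained from the empty tree by inserting the symbols of $u$ from right to left. The relation $u\equiv_{\mathrm{taig}}v\iff\mathrm{P}_{\mathrm{taig}}(u)=\mathrm{P}_{\mathrm{taig}}(v)$ is a congruence, and $\mathrm{taig}_n=[n]^*/{\equiv_{\mathrm{taig}}}$. *)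

theory Defs
  imports "HOL-Library.Tree" "HOL-Algebra.Group" "Jordan_Normal_Form.Matrix"
begin

section \<open>The taiga monoid\<close>

text \<open>A vertex of a binary search tree with multiplicities carries the pair
  (label, multiplicity).\<close>

type_synonym bstm = "(nat \<times> nat) tree"

fun taig_insert :: "nat \<Rightarrow> bstm \<Rightarrow> bstm" where
  "taig_insert a Leaf = Node Leaf (a, 1) Leaf"
| "taig_insert a (Node l (x, k) r) =
     (if a < x then Node (taig_insert a l) (x, k) r
      else if a > x then Node l (x, k) (taig_insert a r)
      else Node l (x, k + 1) r)"

text \<open>\<^const>\<open>foldr\<close> processes the word from right to left.\<close>

definition P_taig :: "nat list \<Rightarrow> bstm" where
  "P_taig u = foldr taig_insert u Leaf"

definition taig_rel :: "nat \<Rightarrow> (nat list \<times> nat list) set" where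
  "taig_rel n = {(u, v). u \<in> lists {1..n} \<and> v \<in> lists {1..n} \<and> P_taig u = P_taig v}"

definition taig :: "nat \<Rightarrow> nat list set monoid" where
  "taig n =
     \<lparr> carrier = lists {1..n} // taig_rel n,
       mult = (\<lambda>X Y. \<Union>u\<in>X. \<Union>v\<in>Y. taig_rel n `` {u @ v}),
       one = taig_rel n `` {[]} \<rparr>"

subsection \<open>The defining relation is a congruence\<close>

lemma equiv_taig_rel: "equiv (lists {1..n}) (taig_rel n)"
  by (rule equivI) (auto simp: taig_rel_def refl_on_def sym_def trans_def)

fun below :: "nat \<Rightarrow> bstm \<Rightarrow> bstm" where
  "below b Leaf = Leaf"
| "below b (Node l (x, k) r) = (if x < b then Node l (x, k) (below b r) else below b l)"

fun above :: "nat \<Rightarrow> bstm \<Rightarrow> bstm" where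
  "above b Leaf = Leaf"
| "above b (Node l (x, k) r) = (if b < x then Node (above b l) (x, k) r else above b r)"

fun multiplicity_in :: "nat \<Rightarrow> bstm \<Rightarrow> nat" where
  "multiplicity_in a Leaf = 0"
| "multiplicity_in a (Node l (x, k) r) =
     (if a < x then multiplicity_in a l else if a > x then multiplicity_in a r else k)"

lemma below_insert:
  "below b (taig_insert a t) = (if a < b then taig_insert a (below b t) else below b t)"
  by (induction a t rule: taig_insert.induct) auto

lemma above_insert:
  "above b (taig_insert a t) = (if b < a then taig_insert a (above b t) else above b t)"
  by (induction a t rule: taig_insert.induct) auto

lemma multiplicity_in_insert:
  "multiplicity_in b (taig_insert a t) = multiplicity_in b t + (if a = b then 1 else 0)"
  by (induction a t rule: taig_insert.induct) auto

lemma P_taig_filter_less: "P_taig (filter (\<lambda>a. a < b) u) = below b (P_taig u)"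
  by (induction u) (auto simp: P_taig_def below_insert)

lemma P_taig_filter_greater: "P_taig (filter (\<lambda>a. b < a) u) = above b (P_taig u)"
  by (induction u) (auto simp: P_taig_def above_insert)

lemma count_list_P_taig: "count_list u b = multiplicity_in b (P_taig u)"
  by (induction u) (auto simp: P_taig_def multiplicity_in_insert)

lemma foldr_taig_insert_Node:
  "foldr taig_insert u (Node l (x, k) r) =
     Node (foldr taig_insert (filter (\<lambda>a. a < x) u) l) (x, k + count_list u x)
          (foldr taig_insert (filter (\<lambda>a. x < a) u) r)"
  by (induction u) auto

lemma foldr_taig_insert_cong:
  assumes "P_taig u = P_taig v"
  shows "foldr taig_insert u t = foldr taig_insert v t"
  using assms
proof (induction t arbitrary: u v)
  case Leaf
  then show ?case by (simp add: P_taig_def)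
next
  case (Node l xk r)
  obtain x k where xk: "xk = (x, k)" by force
  show ?case
    unfolding xk foldr_taig_insert_Node count_list_P_taig
    using Node.IH Node.prems by (auto simp: P_taig_filter_less P_taig_filter_greater)
qed

lemma P_taig_append_cong:
  assumes "P_taig u = P_taig u'" "P_taig v = P_taig v'"
  shows "P_taig (u @ v) = P_taig (u' @ v')"
  using assms foldr_taig_insert_cong[OF assms(1)] by (simp add: P_taig_def)

lemma taig_rel_append:
  "(u, u') \<in> taig_rel n \<Longrightarrow> (v, v') \<in> taig_rel n \<Longrightarrow> (u @ v, u' @ v') \<in> taig_rel n"
  by (auto simp: taig_rel_def intro: P_taig_append_cong)

lemma taig_mult_class:
  assumes "u \<in> lists {1..n}" "v \<in> lists {1..n}"
  shows "taig_rel n `` {u} \<otimes>\<^bsub>taig n\<^esub> taig_rel n `` {v} = taig_rel n `` {u @ v}"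
proof -
  have "congruent2 (taig_rel n) (taig_rel n) (\<lambda>u v. taig_rel n `` {u @ v})"
  proof (rule congruent2I')
    fix u u' v v' assume "(u, u') \<in> taig_rel n" "(v, v') \<in> taig_rel n"
    then show "taig_rel n `` {u @ v} = taig_rel n `` {u' @ v'}"
      by (rule equiv_class_eq[OF equiv_taig_rel taig_rel_append])
  qed
  from UN_equiv_class2[OF equiv_taig_rel equiv_taig_rel this assms]
  show ?thesis by (simp add: taig_def)
qed

lemma carrier_taig: "carrier (taig n) = (\<lambda>u. taig_rel n `` {u}) ` lists {1..n}"
  by (simp add: taig_def quotient_def UNION_singleton_eq_range)

lemma one_taig: "\<one>\<^bsub>taig n\<^esub> = taig_rel n `` {[]}"
  by (simp add: taig_def)

lemma monoid_taig: "monoid (taig n)"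
proof (rule monoidI)
  show "\<one>\<^bsub>taig n\<^esub> \<in> carrier (taig n)"
    unfolding carrier_taig one_taig by (rule imageI) simp
next
  fix X Y assume "X \<in> carrier (taig n)" "Y \<in> carrier (taig n)"
  then obtain u v where uv: "u \<in> lists {1..n}" "v \<in> lists {1..n}"
    "X = taig_rel n `` {u}" "Y = taig_rel n `` {v}" by (auto simp only: carrier_taig)
  show "X \<otimes>\<^bsub>taig n\<^esub> Y \<in> carrier (taig n)"
    unfolding uv(3,4) taig_mult_class[OF uv(1,2)] carrier_taig
    using uv(1,2) by (intro imageI) simp
next
  fix X Y Z assume "X \<in> carrier (taig n)" "Y \<in> carrier (taig n)" "Z \<in> carrier (taig n)"
  then obtain u v w where uvw: "u \<in> lists {1..n}" "v \<in> lists {1..n}" "w \<in> lists {1..n}"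
    "X = taig_rel n `` {u}" "Y = taig_rel n `` {v}" "Z = taig_rel n `` {w}"
    by (auto simp only: carrier_taig)
  have "u @ v \<in> lists {1..n}" "v @ w \<in> lists {1..n}" using uvw(1-3) by simp_all
  then show "X \<otimes>\<^bsub>taig n\<^esub> Y \<otimes>\<^bsub>taig n\<^esub> Z = X \<otimes>\<^bsub>taig n\<^esub> (Y \<otimes>\<^bsub>taig n\<^esub> Z)"
    unfolding uvw(4-6) using uvw(1-3) by (simp only: taig_mult_class append_assoc)
next
  fix X assume "X \<in> carrier (taig n)"
  then obtain u where u: "u \<in> lists {1..n}" "X = taig_rel n `` {u}"
    by (auto simp only: carrier_taig)
  show "\<one>\<^bsub>taig n\<^esub> \<otimes>\<^bsub>taig n\<^esub> X = X" "X \<otimes>\<^bsub>taig n\<^esub> \<one>\<^bsub>taig n\<^esub> = X"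
    unfolding one_taig u(2) using u(1) by (simp_all only: taig_mult_class lists.Nil append.simps append_Nil2)
qed

section \<open>Upper triangular matrices over a semiring\<close>

definition UT :: "'a::semiring_1 itself \<Rightarrow> nat \<Rightarrow> 'a mat monoid" where
  "UT ty m =
     \<lparr> carrier = {A \<in> carrier_mat m m. upper_triangular A}, mult = (*), one = 1\<^sub>m m \<rparr>"

lemma monoid_UT: "monoid (UT TYPE('a::semiring_1) m)"
proof (rule monoidI)
  fix A B assume "A \<in> carrier (UT TYPE('a) m)" "B \<in> carrier (UT TYPE('a) m)"
  then have A: "A \<in> carrier_mat m m" "upper_triangular A"
    and B: "B \<in> carrier_mat m m" "upper_triangular B" by (auto simp: UT_def)
  have "(A * B) $$ (i, j) = 0" if "j < i" "i < m" for i j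
  proof -
    have "(A * B) $$ (i, j) = (\<Sum>k\<in>{0..<m}. A $$ (i, k) * B $$ (k, j))"
      using that A(1) B(1) by (simp add: scalar_prod_def)
    also have "\<dots> = 0"
    proof (rule sum.neutral, rule ballI)
      fix k assume k: "k \<in> {0..<m}"
      show "A $$ (i, k) * B $$ (k, j) = 0"
      proof (cases "k < i")
        case True
        then show ?thesis using upper_triangularD[OF A(2)] that A(1) by simp
      next
        case False
        then show ?thesis using upper_triangularD[OF B(2), of j k] that k B(1) by simp
      qed
    qed
    finally show ?thesis .
  qed
  then show "A \<otimes>\<^bsub>UT TYPE('a) m\<^esub> B \<in> carrier (UT TYPE('a) m)"
    using A(1) B(1) by (auto simp: UT_def)
qed (auto simp: UT_def)

section \<open>Representations\<close>

definition faithful_rep :: "('g, 'c) monoid_scheme \<Rightarrow> nat \<Rightarrow> ('g \<Rightarrow> 'a::semiring_1 mat) \<Rightarrow> bool" where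
  "faithful_rep M m \<phi> \<longleftrightarrow>
     \<phi> \<in> hom M (UT TYPE('a) m) \<and>
     \<phi> \<one>\<^bsub>M\<^esub> = \<one>\<^bsub>UT TYPE('a) m\<^esub> \<and>
     inj_on \<phi> (carrier M)"

text \<open>The matrix is block-diagonal with square diagonal blocks of sizes \<open>ks\<close>, in this order.\<close>

definition block_diagonal :: "nat list \<Rightarrow> 'a::zero mat \<Rightarrow> bool" where
  "block_diagonal ks A \<longleftrightarrow>
     (\<exists>Bs. A = diag_block_mat Bs \<and> map dim_row Bs = ks \<and> (\<forall>B\<in>set Bs. square_mat B))"

definition infinite_mult_order :: "'a::monoid_mult \<Rightarrow> bool" where
  "infinite_mult_order a \<longleftrightarrow> inj (\<lambda>k::nat. a ^ k)"

end

theory Submission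
  imports Defs
begin

text \<open>Inserting from right to left puts the last letter of a word \<open>u\<close> at the root of \<open>P_taig u\<close>,
  and the two subtrees are the trees of the subwords of smaller and of larger letters. Unfolding
  this recursively, the tree is known as soon as one knows how often each letter occurs and which
  letter comes last in each subword of \<open>u\<close> obtained by restricting to an interval of letters
  (\<open>P_taig_eqI\<close>). For the second kind of information it suffices to compare two letters at a time:
  if \<open>u\<close> and \<open>v\<close> disagree on an interval, with last letters \<open>i\<close> and \<open>k\<close>, then they already disagree
  on the interval spanned by \<open>i\<close> and \<open>k\<close>, where the question has become whether an endpoint of the
  interval comes last (\<open>last_in_interval_eqI\<close>).

  Both kinds of information are multiplicative. The number of occurrences of \<open>i\<close> is recorded by
  the power \<open>a ^ count_list u i\<close> of an element \<open>a\<close> of infinite order, in a block of size \<open>1\<close>. The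
  last letter of a product is the last letter of the right factor, unless the right factor is
  empty; so last letters multiply as in a right zero semigroup with an identity adjoined, and such
  a monoid is faithfully represented by upper triangular matrices that vanish outside their first
  row and start with the entry \<open>1\<close> (\<open>reset_mat_mult\<close>). With a first row that has one more entry for
  each endpoint \<open>i\<close> and \<open>j\<close>, the block of an ordered pair of distinct letters has size \<open>3\<close>, and
  the total size is \<open>n + 3 * n * (n - 1) = 3 * n^2 - 2 * n\<close>.\<close>

section \<open>The tree of a word is determined by counts and last letters\<close>

lemma set_eq_of_count_list_eq:
  assumes "\<And>x. count_list u x = count_list v x"
  shows "set u = set v"
  using assms by (metis count_list_0_iff subsetI subset_antisym)

lemma count_list_filter: "count_list (filter P u) x = (if P x then count_list u x else 0)"
  by (induction u) auto

lemma P_taig_snoc: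
  "P_taig (u @ [x]) =
     Node (P_taig (filter (\<lambda>a. a < x) u)) (x, Suc (count_list u x)) (P_taig (filter (\<lambda>a. x < a) u))"
  by (simp add: P_taig_def foldr_taig_insert_Node)

lemma P_taig_eq_Leaf_iff: "P_taig u = Leaf \<longleftrightarrow> u = []"
  by (cases u rule: rev_cases) (simp_all add: P_taig_snoc, simp add: P_taig_def)

lemma P_taig_eq_last:
  assumes "P_taig u = P_taig v" "u \<noteq> []"
  shows "last u = last v"
proof -
  have "v \<noteq> []" using assms by (metis P_taig_eq_Leaf_iff)
  then show ?thesis
    using assms by (cases u rule: rev_cases; cases v rule: rev_cases) (auto simp: P_taig_snoc)
qed

lemma P_taig_filter_interval:
  assumes "P_taig u = P_taig v"
  shows "P_taig (filter (\<lambda>a. a \<in> {b..c}) u) = P_taig (filter (\<lambda>a. a \<in> {b..c}) v)"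
proof -
  have split: "filter (\<lambda>a. a \<in> {b..c}) w =
      (if b = 0 then filter (\<lambda>a. a < Suc c) w
       else filter (\<lambda>a. b - 1 < a) (filter (\<lambda>a. a < Suc c) w))" for w
    by (auto intro!: filter_cong)
  show ?thesis
    unfolding split using assms by (simp add: P_taig_filter_less P_taig_filter_greater del: filter_filter)
qed

text \<open>Half-open intervals are closed under intersection with the letters below, and with the
  letters above, a given letter, which is what the recursion into the two subtrees requires.\<close>

lemma P_taig_eqI:
  assumes "\<And>x. count_list u x = count_list v x"
    and "\<And>b c. filter (\<lambda>a. a \<in> {b..<c}) u \<noteq> [] \<Longrightarrow>
           last (filter (\<lambda>a. a \<in> {b..<c}) u) = last (filter (\<lambda>a. a \<in> {b..<c}) v)"
  shows "P_taig u = P_taig v"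
  using assms
proof (induction "length u" arbitrary: u v rule: less_induct)
  case less
  have set_eq: "set u = set v"
    by (rule set_eq_of_count_list_eq[OF less.prems(1)])
  show ?case
  proof (cases u rule: rev_cases)
    case Nil
    then show ?thesis using set_eq by simp
  next
    case (snoc u' x)
    obtain v' y where v: "v = v' @ [y]"
      using set_eq snoc by (cases v rule: rev_cases) auto
    \<comment> \<open>An interval that contains every letter compares the last letters of the whole words.\<close>
    have all: "filter (\<lambda>a. a \<in> {0..<Suc (Max (set u))}) w = w" if "set w = set u" for w
      using that by (auto simp: filter_id_conv less_Suc_eq_le)
    have "x = y"
      using less.prems(2)[of 0 "Suc (Max (set u))", unfolded all[OF refl] all[OF set_eq[symmetric]]]
      by (simp add: snoc v)
    have "P_taig (filter (\<lambda>a. a < x) u') = P_taig (filter (\<lambda>a. a < x) v')"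
    proof (rule less.hyps)
      show "length (filter (\<lambda>a. a < x) u') < length u"
        using snoc by (simp add: le_imp_less_Suc)
      show "count_list (filter (\<lambda>a. a < x) u') z = count_list (filter (\<lambda>a. a < x) v') z" for z
        using less.prems(1)[of z] \<open>x = y\<close> snoc v
        by (simp add: count_list_filter split: if_splits)
      fix b c
      have restrict: "filter (\<lambda>a. a \<in> {b..<c}) (filter (\<lambda>a. a < x) w) =
          filter (\<lambda>a. a \<in> {b..<min c x}) (w @ [x])" for w
        by (auto intro!: filter_cong)
      show "last (filter (\<lambda>a. a \<in> {b..<c}) (filter (\<lambda>a. a < x) u')) =
          last (filter (\<lambda>a. a \<in> {b..<c}) (filter (\<lambda>a. a < x) v'))"
        if "filter (\<lambda>a. a \<in> {b..<c}) (filter (\<lambda>a. a < x) u') \<noteq> []"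
        using that less.prems(2)[of b "min c x"] \<open>x = y\<close> snoc v unfolding restrict by simp
    qed
    moreover have "P_taig (filter (\<lambda>a. x < a) u') = P_taig (filter (\<lambda>a. x < a) v')"
    proof (rule less.hyps)
      show "length (filter (\<lambda>a. x < a) u') < length u"
        using snoc by (simp add: le_imp_less_Suc)
      show "count_list (filter (\<lambda>a. x < a) u') z = count_list (filter (\<lambda>a. x < a) v') z" for z
        using less.prems(1)[of z] \<open>x = y\<close> snoc v
        by (simp add: count_list_filter split: if_splits)
      fix b c
      have restrict: "filter (\<lambda>a. a \<in> {b..<c}) (filter (\<lambda>a. x < a) w) =
          filter (\<lambda>a. a \<in> {max b (Suc x)..<c}) (w @ [x])" for w
        by (auto intro!: filter_cong)
      show "last (filter (\<lambda>a. a \<in> {b..<c}) (filter (\<lambda>a. x < a) u')) =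
          last (filter (\<lambda>a. a \<in> {b..<c}) (filter (\<lambda>a. x < a) v'))"
        if "filter (\<lambda>a. a \<in> {b..<c}) (filter (\<lambda>a. x < a) u') \<noteq> []"
        using that less.prems(2)[of "max b (Suc x)" c] \<open>x = y\<close> snoc v unfolding restrict by simp
    qed
    moreover have "count_list u' x = count_list v' x"
      using less.prems(1)[of x] \<open>x = y\<close> snoc v by simp
    ultimately show ?thesis
      using \<open>x = y\<close> by (simp add: snoc v P_taig_snoc)
  qed
qed

lemma last_filter_mono:
  assumes "filter P u \<noteq> []" "Q (last (filter P u))" "\<And>a. Q a \<Longrightarrow> P a"
  shows "filter Q u \<noteq> [] \<and> last (filter Q u) = last (filter P u)"
  using assms by (induction u rule: rev_induct) (auto split: if_splits)

text \<open>The last letters \<open>i\<close> of \<open>u\<close> and \<open>k\<close> of \<open>v\<close> in a large interval remain last in the interval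
  spanned by \<open>i\<close> and \<open>k\<close>; there the word \<open>u\<close> ends in \<open>i\<close>, so \<open>v\<close> does as well, and \<open>i = k\<close>.\<close>

lemma last_in_interval_eqI:
  fixes u v :: "nat list"
  assumes set_eq: "set u = set v"
    and ends: "\<And>i j. i \<in> set u \<Longrightarrow> j \<in> set u \<Longrightarrow> i \<noteq> j \<Longrightarrow>
      last (filter (\<lambda>a. a \<in> {min i j..max i j}) u) = i \<Longrightarrow>
      last (filter (\<lambda>a. a \<in> {min i j..max i j}) v) = i"
    and ne: "filter (\<lambda>a. a \<in> {b..<c}) u \<noteq> []"
  shows "last (filter (\<lambda>a. a \<in> {b..<c}) u) = last (filter (\<lambda>a. a \<in> {b..<c}) v)"
proof (rule ccontr)
  define i where "i = last (filter (\<lambda>a. a \<in> {b..<c}) u)"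
  define k where "k = last (filter (\<lambda>a. a \<in> {b..<c}) v)"
  let ?J = "{min i k..max i k}"
  assume "\<not> ?thesis"
  then have "i \<noteq> k" by (simp add: i_def k_def)
  have nev: "filter (\<lambda>a. a \<in> {b..<c}) v \<noteq> []"
    using ne set_eq by (simp add: filter_empty_conv)
  have i: "i \<in> set u" "i \<in> {b..<c}"
    using last_in_set[OF ne] unfolding i_def[symmetric] by simp_all
  have k: "k \<in> set u" "k \<in> {b..<c}"
    using last_in_set[OF nev] unfolding k_def[symmetric] by (simp_all add: set_eq)
  have sub: "a \<in> {b..<c}" if "a \<in> ?J" for a
    using that i(2) k(2) by auto
  have "last (filter (\<lambda>a. a \<in> ?J) u) = i"
    using last_filter_mono[OF ne, of "\<lambda>a. a \<in> ?J"] sub unfolding i_def[symmetric] by simp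
  then have "last (filter (\<lambda>a. a \<in> ?J) v) = i"
    by (rule ends[OF i(1) k(1) \<open>i \<noteq> k\<close>])
  moreover have "last (filter (\<lambda>a. a \<in> ?J) v) = k"
    using last_filter_mono[OF nev, of "\<lambda>a. a \<in> ?J"] sub unfolding k_def[symmetric] by simp
  ultimately show False using \<open>i \<noteq> k\<close> by simp
qed

section \<open>Upper triangular representations of the free monoid\<close>

definition word_rep :: "nat \<Rightarrow> ('b list \<Rightarrow> 'a::semiring_1 mat) \<Rightarrow> bool" where
  "word_rep m f \<longleftrightarrow>
     (\<forall>u. f u \<in> carrier_mat m m \<and> upper_triangular (f u)) \<and>
     f [] = 1\<^sub>m m \<and> (\<forall>u v. f (u @ v) = f u * f v)"

definition diag_rep :: "(nat \<times> ('b list \<Rightarrow> 'a::zero mat)) list \<Rightarrow> 'b list \<Rightarrow> 'a mat" where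
  "diag_rep kfs u = diag_block_mat (map (\<lambda>(k, f). f u) kfs)"

lemma diag_rep_Cons:
  assumes "f u \<in> carrier_mat k k" "diag_rep kfs u \<in> carrier_mat m m"
  shows "diag_rep ((k, f) # kfs) u = four_block_mat (f u) (0\<^sub>m k m) (0\<^sub>m m k) (diag_rep kfs u)"
  using assms by (auto simp: diag_rep_def Let_def)

lemma word_rep_diag_rep:
  assumes "\<And>k f. (k, f) \<in> set kfs \<Longrightarrow> word_rep k f"
  shows "word_rep (sum_list (map fst kfs)) (diag_rep kfs)"
  using assms
proof (induction kfs)
  case Nil
  show ?case by (auto simp: word_rep_def diag_rep_def)
next
  case (Cons kf kfs)
  obtain k f where kf: "kf = (k, f)" by force
  define m where "m = sum_list (map fst kfs)"
  have f: "f u \<in> carrier_mat k k" "upper_triangular (f u)" "f [] = 1\<^sub>m k" "f (u @ v) = f u * f v" for u v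
    using Cons.prems[of k f] kf by (auto simp: word_rep_def)
  have "word_rep m (diag_rep kfs)"
    unfolding m_def by (rule Cons.IH) (use Cons.prems in auto)
  then have g: "diag_rep kfs u \<in> carrier_mat m m" "upper_triangular (diag_rep kfs u)"
    "diag_rep kfs [] = 1\<^sub>m m" "diag_rep kfs (u @ v) = diag_rep kfs u * diag_rep kfs v" for u v
    by (auto simp: word_rep_def)
  note step = diag_rep_Cons[OF f(1) g(1)]
  have "word_rep (k + m) (diag_rep ((k, f) # kfs))"
    unfolding word_rep_def step
  proof (intro conjI allI)
    fix u v
    show "four_block_mat (f u) (0\<^sub>m k m) (0\<^sub>m m k) (diag_rep kfs u) \<in> carrier_mat (k + m) (k + m)"
      by (rule four_block_carrier_mat[OF f(1) g(1)])
    show "upper_triangular (four_block_mat (f u) (0\<^sub>m k m) (0\<^sub>m m k) (diag_rep kfs u))"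
      by (rule upper_triangular_four_block[OF f(1) g(1) f(2) g(2)])
    show "four_block_mat (f (u @ v)) (0\<^sub>m k m) (0\<^sub>m m k) (diag_rep kfs (u @ v)) =
        four_block_mat (f u) (0\<^sub>m k m) (0\<^sub>m m k) (diag_rep kfs u) *
        four_block_mat (f v) (0\<^sub>m k m) (0\<^sub>m m k) (diag_rep kfs v)"
      using f(1)[of u] f(1)[of v] g(1)[of u] g(1)[of v]
      by (simp add: mult_four_block_mat[OF f(1) _ _ g(1) f(1) _ _ g(1)] f(4) g(4))
  qed (simp add: f(3) g(3))
  then show ?case by (simp add: kf m_def)
qed

lemma diag_rep_eq_blocks:
  assumes "\<And>k f. (k, f) \<in> set kfs \<Longrightarrow> word_rep k f"
    and "diag_rep kfs u = diag_rep kfs v" "(k, f) \<in> set kfs"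
  shows "f u = f v"
  using assms
proof (induction kfs)
  case (Cons kf kfs)
  obtain l h where kf: "kf = (l, h)" by force
  define m where "m = sum_list (map fst kfs)"
  have h: "h w \<in> carrier_mat l l" for w
    using Cons.prems(1)[of l h] kf by (auto simp: word_rep_def)
  have "word_rep m (diag_rep kfs)"
    unfolding m_def by (rule word_rep_diag_rep) (use Cons.prems(1) in auto)
  then have g: "diag_rep kfs w \<in> carrier_mat m m" for w
    by (auto simp: word_rep_def)
  let ?F = "\<lambda>w. four_block_mat (h w) (0\<^sub>m l m) (0\<^sub>m m l) (diag_rep kfs w)"
  have eq: "?F u = ?F v"
    using Cons.prems(2) unfolding kf diag_rep_Cons[OF h g] .
  have upper: "h w $$ (i, j) = ?F w $$ (i, j)" if "i < l" "j < l" for w i j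
    using that h[of w] g[of w] by auto
  have lower: "diag_rep kfs w $$ (i, j) = ?F w $$ (l + i, l + j)" if "i < m" "j < m" for w i j
    using that h[of w] g[of w] by auto
  have "h u = h v"
  proof (rule eq_matI)
    fix i j assume "i < dim_row (h v)" "j < dim_col (h v)"
    then have ij: "i < l" "j < l" using h[of v] by auto
    show "h u $$ (i, j) = h v $$ (i, j)" by (simp only: upper[OF ij] eq)
  qed (use h[of u] h[of v] in auto)
  moreover have "diag_rep kfs u = diag_rep kfs v"
  proof (rule eq_matI)
    fix i j assume "i < dim_row (diag_rep kfs v)" "j < dim_col (diag_rep kfs v)"
    then have ij: "i < m" "j < m" using g[of v] by auto
    show "diag_rep kfs u $$ (i, j) = diag_rep kfs v $$ (i, j)" by (simp only: lower[OF ij] eq)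
  qed (use g[of u] g[of v] in auto)
  ultimately show ?case
    using Cons.IH Cons.prems(1,3) kf by auto
qed simp

lemma block_diagonal_diag_rep:
  assumes "\<And>k f. (k, f) \<in> set kfs \<Longrightarrow> word_rep k f"
  shows "block_diagonal (map fst kfs) (diag_rep kfs u)"
  unfolding block_diagonal_def
proof (intro exI conjI)
  let ?Bs = "map (\<lambda>(k, f). f u) kfs"
  have f: "f u \<in> carrier_mat k k" if "(k, f) \<in> set kfs" for k f
    using assms[OF that] by (simp add: word_rep_def)
  show "diag_rep kfs u = diag_block_mat ?Bs" by (simp add: diag_rep_def)
  show "map dim_row ?Bs = map fst kfs" using f by fastforce
  show "\<forall>B\<in>set ?Bs. square_mat B" using f by fastforce
qed

text \<open>A representation of words whose kernel is the taiga congruence descends to a faithful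
  representation of the quotient; it is constant on each class, so \<^const>\<open>the_elem\<close> extracts its
  value there.\<close>

lemma faithful_rep_taig:
  fixes f :: "nat list \<Rightarrow> 'a::semiring_1 mat"
  assumes "word_rep m f"
    and ker: "\<And>u v. u \<in> lists {1..n} \<Longrightarrow> v \<in> lists {1..n} \<Longrightarrow> f u = f v \<longleftrightarrow> P_taig u = P_taig v"
  shows "faithful_rep (taig n) m (\<lambda>X. the_elem (f ` X))"
    and "\<And>X. X \<in> carrier (taig n) \<Longrightarrow> \<exists>u. the_elem (f ` X) = f u"
proof -
  have f: "f u \<in> carrier_mat m m" "upper_triangular (f u)" "f [] = 1\<^sub>m m" "f (u @ v) = f u * f v" for u v
    using assms(1) by (auto simp: word_rep_def)
  have val: "the_elem (f ` (taig_rel n `` {u})) = f u" if "u \<in> lists {1..n}" for u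
  proof -
    have "u \<in> taig_rel n `` {u}"
      using that by (simp add: taig_rel_def)
    moreover have "f w = f u" if "w \<in> taig_rel n `` {u}" for w
    proof -
      have "u \<in> lists {1..n}" "w \<in> lists {1..n}" "P_taig u = P_taig w"
        using that unfolding taig_rel_def by blast+
      then show ?thesis using ker by metis
    qed
    ultimately have "f ` (taig_rel n `` {u}) = {f u}" by blast
    then show ?thesis by simp
  qed
  show "\<exists>u. the_elem (f ` X) = f u" if "X \<in> carrier (taig n)" for X
    using that val unfolding carrier_taig by auto
  show "faithful_rep (taig n) m (\<lambda>X. the_elem (f ` X))"
    unfolding faithful_rep_def
  proof (intro conjI homI inj_onI)
    fix X Y assume "X \<in> carrier (taig n)" "Y \<in> carrier (taig n)"
    then obtain u v where uv: "u \<in> lists {1..n}" "v \<in> lists {1..n}"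
      and XY: "X = taig_rel n `` {u}" "Y = taig_rel n `` {v}"
      unfolding carrier_taig by auto
    have uv': "u @ v \<in> lists {1..n}" using uv by simp
    show "the_elem (f ` X) \<in> carrier (UT TYPE('a) m)"
      unfolding XY val[OF uv(1)] using f(1,2) by (simp add: UT_def)
    show "the_elem (f ` (X \<otimes>\<^bsub>taig n\<^esub> Y)) =
        the_elem (f ` X) \<otimes>\<^bsub>UT TYPE('a) m\<^esub> the_elem (f ` Y)"
      unfolding XY taig_mult_class[OF uv] val[OF uv(1)] val[OF uv(2)] val[OF uv']
      by (simp add: UT_def f(4))
    assume "the_elem (f ` X) = the_elem (f ` Y)"
    then have "f u = f v"
      unfolding XY val[OF uv(1)] val[OF uv(2)] .
    then have "(u, v) \<in> taig_rel n"
      using uv ker[OF uv] by (simp add: taig_rel_def)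
    then show "X = Y"
      unfolding XY by (rule equiv_class_eq[OF equiv_taig_rel])
  next
    show "the_elem (f ` \<one>\<^bsub>taig n\<^esub>) = \<one>\<^bsub>UT TYPE('a) m\<^esub>"
      unfolding one_taig using val[of "[]"] f(3) by (simp add: UT_def)
  qed
qed

section \<open>Blocks recording counts and last letters\<close>

definition count_block :: "'a::semiring_1 \<Rightarrow> nat \<Rightarrow> nat list \<Rightarrow> 'a mat" where
  "count_block a i u = mat 1 1 (\<lambda>_. a ^ count_list u i)"

lemma word_rep_count_block: "word_rep 1 (count_block a i)"
  by (auto simp: word_rep_def count_block_def scalar_prod_def power_add intro!: eq_matI)

text \<open>If \<open>R\<close> vanishes outside its first row, then \<open>M * R\<close> is the first column of \<open>M\<close> times the
  first row of \<open>R\<close>. When that column is the first unit vector, the product is \<open>R\<close>: the right factor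
  forgets everything to its left.\<close>

definition reset_mat :: "'a::semiring_1 \<Rightarrow> 'a \<Rightarrow> 'a mat" where
  "reset_mat x y = mat 3 3 (\<lambda>(r, s). if r = 0 then (if s = 0 then 1 else if s = 1 then x else y) else 0)"

lemma reset_mat_carrier: "reset_mat x y \<in> carrier_mat 3 3"
  by (simp add: reset_mat_def)

lemma reset_mat_mult: "reset_mat x y * reset_mat x' y' = reset_mat x' y'"
  by (rule eq_matI) (auto simp: reset_mat_def scalar_prod_def eval_nat_numeral)

text \<open>The blocks of \<open>(i, j)\<close> and \<open>(j, i)\<close> look at the same interval and interchange the two columns
  that record its endpoints. A word without letters in the interval plays the part of the identity
  adjoined to the right zero semigroup.\<close>

definition last_block :: "nat \<Rightarrow> nat \<Rightarrow> nat list \<Rightarrow> 'a::semiring_1 mat" where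
  "last_block i j u =
     (let w = filter (\<lambda>a. a \<in> {min i j..max i j}) u
      in if w = [] then 1\<^sub>m 3 else reset_mat (of_bool (last w = i)) (of_bool (last w = j)))"

lemma word_rep_last_block: "word_rep 3 (last_block i j)"
proof -
  have "last_block i j u \<in> carrier_mat 3 3" for u
    by (simp add: last_block_def Let_def reset_mat_carrier)
  moreover have "upper_triangular (last_block i j u)" for u
    by (auto simp: last_block_def Let_def reset_mat_def)
  moreover have "last_block i j (u @ v) = last_block i j u * last_block i j v" for u v
    by (simp add: last_block_def Let_def reset_mat_mult left_mult_one_mat[OF reset_mat_carrier]
        right_mult_one_mat[OF reset_mat_carrier] del: atLeastAtMost_iff)
  moreover have "last_block i j [] = 1\<^sub>m 3"
    by (simp add: last_block_def)
  ultimately show ?thesis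
    unfolding word_rep_def by blast
qed

text \<open>A single entry tells whether \<open>i\<close> comes last: it also vanishes in the identity matrix.\<close>

lemma last_block_entry:
  "last_block i j u $$ (0, 1) =
     of_bool (filter (\<lambda>a. a \<in> {min i j..max i j}) u \<noteq> [] \<and>
              last (filter (\<lambda>a. a \<in> {min i j..max i j}) u) = i)"
  by (simp add: last_block_def Let_def reset_mat_def del: atLeastAtMost_iff)

lemma last_block_cong:
  assumes "P_taig u = P_taig v"
  shows "last_block i j u = last_block i j v"
proof -
  note eq = P_taig_filter_interval[OF assms, of "min i j" "max i j"]
  show ?thesis
    using P_taig_eq_last[OF eq] eq P_taig_eq_Leaf_iff unfolding last_block_def Let_def by metis
qed

definition taig_blocks :: "'a::semiring_1 \<Rightarrow> nat \<Rightarrow> (nat \<times> (nat list \<Rightarrow> 'a mat)) list" where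
  "taig_blocks a n =
     map (\<lambda>i. (1, count_block a i)) [1..<Suc n] @
     map (\<lambda>(i, j). (3, last_block i j))
       (filter (\<lambda>(i, j). i \<noteq> j) (List.product [1..<Suc n] [1..<Suc n]))"

lemma set_taig_blocks:
  "set (taig_blocks a n) =
     (\<lambda>i. (1, count_block a i)) ` {1..n} \<union>
     (\<lambda>(i, j). (3, last_block i j)) ` {(i, j). i \<in> {1..n} \<and> j \<in> {1..n} \<and> i \<noteq> j}"
  by (auto simp: taig_blocks_def image_iff)

lemma word_rep_taig_blocks: "(k, f) \<in> set (taig_blocks a n) \<Longrightarrow> word_rep k f"
  using word_rep_count_block[where a = a] word_rep_last_block by (auto simp: set_taig_blocks)

lemma length_offdiagonal:
  "length (filter (\<lambda>(i, j). i \<noteq> j) (List.product [1..<Suc n] [1..<Suc n])) = n * n - n"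
proof -
  let ?A = "{1..n}"
  have "length (filter (\<lambda>(i, j). i \<noteq> j) (List.product [1..<Suc n] [1..<Suc n])) =
      card (set (filter (\<lambda>(i, j). i \<noteq> j) (List.product [1..<Suc n] [1..<Suc n])))"
    by (intro distinct_card[symmetric] distinct_filter distinct_product) simp_all
  also have "set (filter (\<lambda>(i, j). i \<noteq> j) (List.product [1..<Suc n] [1..<Suc n])) =
      ?A \<times> ?A - (\<lambda>i. (i, i)) ` ?A"
    by auto
  also have "card \<dots> = n * n - n"
    by (subst card_Diff_subset) (auto simp: card_image inj_on_def card_cartesian_product)
  finally show ?thesis .
qed

lemma sizes_taig_blocks: "map fst (taig_blocks a n) = replicate n 1 @ replicate (n * n - n) 3"
  unfolding length_offdiagonal[symmetric]
  by (simp add: taig_blocks_def o_def case_prod_unfold map_replicate_const del: upt_Suc)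

lemma sum_list_taig_blocks: "sum_list (map fst (taig_blocks a n)) = 3 * n^2 - 2 * n"
proof -
  obtain N where "n * n = N" "n \<le> N" using le_square by blast
  then show ?thesis
    unfolding sizes_taig_blocks by (simp add: sum_list_replicate power2_eq_square)
qed

lemma Max_taig_blocks:
  assumes "n > 0"
  shows "Max (set (map fst (taig_blocks a n))) = (if n = 1 then 1 else 3)"
proof -
  have "n * n - n = 0 \<longleftrightarrow> n = 1"
    using assms by auto
  then show ?thesis
    unfolding sizes_taig_blocks using assms by (simp add: set_replicate_conv_if)
qed

lemma diag_rep_taig_blocks_eq_iff:
  fixes a :: "'a::semiring_1"
  assumes a: "infinite_mult_order a" and uv: "u \<in> lists {1..n}" "v \<in> lists {1..n}"
  shows "diag_rep (taig_blocks a n) u = diag_rep (taig_blocks a n) v \<longleftrightarrow> P_taig u = P_taig v"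
proof
  assume "P_taig u = P_taig v"
  then have "f u = f v" if "(k, f) \<in> set (taig_blocks a n)" for k f
    using that last_block_cong[of u v]
    by (auto simp: set_taig_blocks count_block_def count_list_P_taig)
  then have "map (\<lambda>(k, f). f u) (taig_blocks a n) = map (\<lambda>(k, f). f v) (taig_blocks a n)"
    by auto
  then show "diag_rep (taig_blocks a n) u = diag_rep (taig_blocks a n) v"
    unfolding diag_rep_def by (rule arg_cong)
next
  assume eq: "diag_rep (taig_blocks a n) u = diag_rep (taig_blocks a n) v"
  note block = diag_rep_eq_blocks[OF word_rep_taig_blocks eq]
  have count: "count_list u x = count_list v x" for x
  proof (cases "x \<in> {1..n}")
    case True
    then have "count_block a x u = count_block a x v"
      by (intro block[where k = 1]) (auto simp: set_taig_blocks)
    then have "count_block a x u $$ (0, 0) = count_block a x v $$ (0, 0)"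
      by simp
    then have "a ^ count_list u x = a ^ count_list v x"
      by (simp add: count_block_def)
    then show ?thesis using a by (simp add: infinite_mult_order_def inj_eq)
  next
    case False
    then show ?thesis using uv by (metis count_notin in_lists_conv_set)
  qed
  have set_eq: "set u = set v"
    by (rule set_eq_of_count_list_eq[OF count])
  show "P_taig u = P_taig v"
  proof (rule P_taig_eqI[OF count last_in_interval_eqI[OF set_eq]])
    fix i j :: nat
    let ?J = "{min i j..max i j}"
    assume ij: "i \<in> set u" "j \<in> set u" "i \<noteq> j"
      and last: "last (filter (\<lambda>a. a \<in> ?J) u) = i"
    have "(last_block i j u :: 'a mat) = last_block i j v"
      using ij uv by (intro block[where k = 3]) (auto simp: set_taig_blocks)
    then have "(last_block i j u :: 'a mat) $$ (0, 1) = last_block i j v $$ (0, 1)"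
      by simp
    moreover have "filter (\<lambda>a. a \<in> ?J) u \<noteq> []"
      using ij(1) by (auto simp: filter_empty_conv intro: bexI[of _ i])
    ultimately show "last (filter (\<lambda>a. a \<in> ?J) v) = i"
      unfolding last_block_entry using last by (simp del: atLeastAtMost_iff)
  qed
qed

section \<open>The faithful representation\<close>

theorem theorem5p8:
  fixes n :: nat
  assumes "n > 0"
    and "\<exists>a :: 'a::comm_semiring_1. infinite_mult_order a"
  shows "\<exists>(\<phi> :: nat list set \<Rightarrow> 'a mat) (ks :: nat list).
           faithful_rep (taig n) (3 * n^2 - 2 * n) \<phi> \<and>
           (\<forall>X \<in> carrier (taig n). block_diagonal ks (\<phi> X)) \<and>
           sum_list ks = 3 * n^2 - 2 * n \<and>
           (\<forall>k \<in> set ks. k > 0) \<and>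
           Max (set ks) = (if n = 1 then 1 else 3)"
proof -
  obtain a :: 'a where a: "infinite_mult_order a"
    using assms(2) by blast
  let ?f = "diag_rep (taig_blocks a n)" and ?ks = "map fst (taig_blocks a n)"
  have "word_rep (3 * n^2 - 2 * n) ?f"
    using word_rep_diag_rep[of "taig_blocks a n", OF word_rep_taig_blocks] unfolding sum_list_taig_blocks .
  note rep = faithful_rep_taig[OF this diag_rep_taig_blocks_eq_iff[OF a]]
  have "\<forall>X \<in> carrier (taig n). block_diagonal ?ks (the_elem (?f ` X))"
  proof
    fix X assume "X \<in> carrier (taig n)"
    then obtain u where "the_elem (?f ` X) = ?f u" using rep(2) by blast
    then show "block_diagonal ?ks (the_elem (?f ` X))"
      using block_diagonal_diag_rep[OF word_rep_taig_blocks] by simp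
  qed
  moreover have "\<forall>k \<in> set ?ks. k > 0"
    by (auto simp: set_taig_blocks)
  ultimately show ?thesis
    using rep(1) sum_list_taig_blocks[where a = a] Max_taig_blocks[OF assms(1), where a = a] by blast
qed

end
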